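(* Let $\mathcal A=\mathbb Z/2$ and let $\Phi:\mathcal A^{\mathbb Z}\to\mathcal A^{\mathbb Z}$ be the cellular automaton $\Phi(\mathbf a)_\ell=a_\ell+a_{\ell+1}\pmod2$. If $\mu$ is a dyadically recurrent probability measure on $\mathcal A^{\mathbb Z}$, then $\Phi$ does not asymptotically randomize $\mu$.
   Context: A Borel probability measure $\mu$ on $\mathcal A^{\mathbb Z}$ is dyadically recurrent if there are a sequence of natural numbers $n_k\to\infty$ and constants $\epsilon,\delta>0$ such that $\mu[\mathfrak R_k]>\epsilon$ for all $k$, where $\mathfrak R_k=\{\mathbf a\in\mathcal A^{\mathbb Z}: a_\ell=a_{\ell+2^{n_k}}\text{ for all integers }\ell\text{ with }0\le\ell<\delta2^{n_k}\}$. Let $\eta$ be the $(\frac12,\frac12)$-Bernoulli (uniform product) measure on $\mathcal A^{\mathbb Z}$. $\Phi$ asymptotically randomizes $\mu$ if there is a set $J\subset\mathbb N$ of (Cesàro) density $1$ such that the push-forwards $\Phi^j(\mu)$ converge weak* to $\eta$ as $j\to\infty$ along $j\in J$. *)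

theory Defs
  imports "HOL-Probability.Probability" "HOL-Library.Z2"
begin

text \<open>The alphabet \<open>\<int>/2\<close> is the two-element field \<open>bit\<close> with the discrete topology; configurations
  \<open>int \<Rightarrow> bit\<close> then carry the product topology of the library, and \<open>borel\<close> is its Borel
  sigma-algebra.\<close>

lemma UNIV_bit: "(UNIV :: bit set) = {0, 1}"
  using bit.exhaust by auto

instance bit :: finite
  by standard (simp add: UNIV_bit)

instantiation bit :: discrete_topology
begin

definition open_bit :: "bit set \<Rightarrow> bool" where
  "open_bit S = True"

instance
  by standard (simp_all add: open_bit_def)

end

instance bit :: second_countable_topology
proof
  have "open = generate_topology (UNIV :: bit set set)"
    by (rule ext) (simp add: Topological_Spaces.open_discrete generate_topology.Basis)
  then show "\<exists>B::bit set set. countable B \<and> open = generate_topology B"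
    by (intro exI[of _ UNIV]) (simp add: countable_finite)
qed

lemma borel_bit: "sets (borel :: bit measure) = UNIV"
  by (auto simp: Topological_Spaces.open_discrete)

definition sum_ca :: "(int \<Rightarrow> bit) \<Rightarrow> (int \<Rightarrow> bit)" where
  "sum_ca a = (\<lambda>l. a l + a (l + 1))"

definition uniform_bernoulli :: "(int \<Rightarrow> bit) measure" where
  "uniform_bernoulli = PiM UNIV (\<lambda>_. uniform_count_measure UNIV)"

text \<open>For a real \<open>\<delta> > 1\<close> the range of \<open>l\<close> exceeds \<open>2 ^ n\<close>; this is not excluded.\<close>

definition recurrence_set :: "real \<Rightarrow> nat \<Rightarrow> (int \<Rightarrow> bit) set" where
  "recurrence_set \<delta> n =
    {a. \<forall>l::int. 0 \<le> l \<and> real_of_int l < \<delta> * 2 ^ n \<longrightarrow> a l = a (l + 2 ^ n)}"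

definition dyadically_recurrent :: "(int \<Rightarrow> bit) measure \<Rightarrow> bool" where
  "dyadically_recurrent \<mu> \<longleftrightarrow>
    (\<exists>(n :: nat \<Rightarrow> nat) \<epsilon> \<delta>. filterlim n at_top sequentially \<and> \<epsilon> > 0 \<and> \<delta> > 0 \<and>
      (\<forall>k. measure \<mu> (recurrence_set \<delta> (n k)) > \<epsilon>))"

definition has_density_one :: "nat set \<Rightarrow> bool" where
  "has_density_one J \<longleftrightarrow> (\<lambda>N. real (card (J \<inter> {..<N})) / real N) \<longlonglongrightarrow> 1"

text \<open>Weak* convergence with respect to a filter. The configuration space is compact, so every
  continuous test function is bounded.\<close>

definition weak_star_converges ::
    "('i \<Rightarrow> (int \<Rightarrow> bit) measure) \<Rightarrow> (int \<Rightarrow> bit) measure \<Rightarrow> 'i filter \<Rightarrow> bool" where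
  "weak_star_converges M N F \<longleftrightarrow>
    (\<forall>f :: (int \<Rightarrow> bit) \<Rightarrow> real. continuous_on UNIV f \<longrightarrow>
      ((\<lambda>i. integral\<^sup>L (M i) f) \<longlongrightarrow> integral\<^sup>L N f) F)"

definition asymptotically_randomizes ::
    "((int \<Rightarrow> bit) \<Rightarrow> (int \<Rightarrow> bit)) \<Rightarrow> (int \<Rightarrow> bit) measure \<Rightarrow> bool" where
  "asymptotically_randomizes \<Phi> \<mu> \<longleftrightarrow>
    (\<exists>J. has_density_one J \<and>
      weak_star_converges (\<lambda>j. distr \<mu> borel (\<Phi> ^^ j)) uniform_bernoulli
        (inf sequentially (principal J)))"

text \<open>The definitions above are meaningful only for Borel probability measures and measurable
  maps; the following facts confirm this for the objects at hand.\<close>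

lemma sets_uniform_bernoulli: "sets uniform_bernoulli = sets borel"
proof -
  have "sets uniform_bernoulli = sets (PiM UNIV (\<lambda>_. borel :: bit measure))"
    unfolding uniform_bernoulli_def
    by (intro sets_PiM_cong) (simp_all add: borel_bit sets_uniform_count_measure)
  then show ?thesis
    by (simp add: sets_PiM_equal_borel)
qed

lemma prob_space_uniform_bernoulli: "prob_space uniform_bernoulli"
  unfolding uniform_bernoulli_def
  by (intro prob_space_PiM prob_space_uniform_count_measure) simp_all

lemma emeasure_uniform_bernoulli_cylinder:
  assumes "finite I"
  shows "emeasure uniform_bernoulli {a. \<forall>i\<in>I. a i = w i} = ennreal ((1 / 2) ^ card I)"
proof -
  interpret product_prob_space "\<lambda>_::int. uniform_count_measure (UNIV :: bit set)" UNIV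
    by (intro product_prob_spaceI prob_space_uniform_count_measure) simp_all
  have eq: "{a. \<forall>i\<in>I. a i = w i} =
      prod_emb UNIV (\<lambda>_. uniform_count_measure (UNIV :: bit set)) I (\<Pi>\<^sub>E i\<in>I. {w i})"
    by (auto simp: prod_emb_def space_uniform_count_measure restrict_def PiE_iff)
  have c: "card (UNIV :: bit set) = 2"
    by (simp add: UNIV_bit)
  have "emeasure uniform_bernoulli {a. \<forall>i\<in>I. a i = w i} = inverse 2 ^ card I"
    unfolding uniform_bernoulli_def eq
    by (subst emeasure_PiM_emb)
      (simp_all add: assms emeasure_uniform_count_measure c sets_uniform_count_measure)
  also have "(inverse 2 :: ennreal) = ennreal (1 / 2)"
    using inverse_ennreal[of 2] by (simp add: inverse_eq_divide)
  also have "ennreal (1 / 2) ^ card I = ennreal ((1 / 2) ^ card I)"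
    by (rule ennreal_power) simp
  finally show ?thesis .
qed

lemma open_two_coordinates: "open {a :: int \<Rightarrow> bit. P (a l) (a m)}"
proof -
  have "open ((\<lambda>a :: int \<Rightarrow> bit. a i) -` S)" for i S
    by (rule open_vimage[OF Topological_Spaces.open_discrete continuous_on_product_coordinates])
  then have "open (\<Union>x. \<Union>y\<in>{y. P x y}.
      (\<lambda>a :: int \<Rightarrow> bit. a l) -` {x} \<inter> (\<lambda>a. a m) -` {y})"
    by (intro open_UN ballI open_Int)
  also have "(\<Union>x. \<Union>y\<in>{y. P x y}. (\<lambda>a :: int \<Rightarrow> bit. a l) -` {x} \<inter> (\<lambda>a. a m) -` {y}) =
      {a. P (a l) (a m)}"
    by auto
  finally show ?thesis .
qed

lemma continuous_on_sum_ca: "continuous_on UNIV sum_ca"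
proof (rule continuous_on_coordinatewise_then_product)
  fix l
  have "open ((\<lambda>a. sum_ca a l) -` S)" for S
    using open_two_coordinates[of "\<lambda>x y. x + y \<in> S" l "l + 1"]
    by (simp add: sum_ca_def vimage_def)
  then show "continuous_on UNIV (\<lambda>a. sum_ca a l)"
    by (simp add: continuous_on_open_vimage)
qed

lemma measurable_sum_ca_funpow: "sum_ca ^^ j \<in> borel_measurable borel"
proof (induction j)
  case 0
  show ?case
    by (simp add: id_def)
next
  case (Suc j)
  have "sum_ca \<in> borel_measurable borel"
    by (rule borel_measurable_continuous_onI[OF continuous_on_sum_ca])
  from measurable_comp[OF Suc.IH this] show ?case
    by (simp only: funpow.simps)
qed

lemma recurrence_set_measurable: "recurrence_set \<delta> n \<in> sets borel"
proof -
  have "(\<Inter>l. if 0 \<le> l \<and> real_of_int l < \<delta> * 2 ^ n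
      then {a :: int \<Rightarrow> bit. a l = a (l + 2 ^ n)} else UNIV) \<in> sets borel"
    by (rule sets.countable_INT'')
      (simp_all add: borel_open open_two_coordinates[of "(=)"])
  also have "(\<Inter>l. if 0 \<le> l \<and> real_of_int l < \<delta> * 2 ^ n
      then {a :: int \<Rightarrow> bit. a l = a (l + 2 ^ n)} else UNIV) = recurrence_set \<delta> n"
    by (auto simp: recurrence_set_def split: if_splits)
  finally show ?thesis .
qed

end

theory Submission
  imports Defs
begin

text \<open>In characteristic two the iterates of the automaton at powers of two are sparse:
  \<open>\<Phi> ^ (2 ^ n)\<close> adds to each symbol the one \<open>2 ^ n\<close> places to its right
  (\<open>sum_ca_funpow_power_two\<close>). A configuration in the recurrence set repeats itself at exactly that
  distance, so these two symbols cancel and \<open>\<Phi> ^ (2 ^ n)\<close> wipes out the whole window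
  \<open>[0, \<delta> 2 ^ n)\<close>. Since the automaton has range one, a block of zeros is eaten up only from its
  right end, one cell per step (\<open>sum_ca_funpow_zero_block\<close>). Hence the first \<open>M\<close> symbols stay zero
  at all times from \<open>2 ^ n\<close> to about \<open>(1 + \<delta>) 2 ^ n\<close> (\<open>recurrence_set_subset\<close>).

  This stretch of times occupies a fixed positive proportion of its initial segment, so a set \<open>J\<close>
  of density one meets it once \<open>n\<close> is large (\<open>density_one_meets_intervals\<close>). There are thus
  arbitrarily late times \<open>j \<in> J\<close> at which \<open>\<Phi>\<^sup>j \<mu>\<close> gives the cylinder of \<open>M\<close> zeros a mass larger
  than \<open>\<epsilon>\<close>. The Bernoulli measure gives it only \<open>2 ^ -M\<close>, which for large \<open>M\<close> is below \<open>\<epsilon>\<close>. As the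
  indicator of a cylinder is continuous, weak* convergence along \<open>J\<close> is impossible.\<close>

text \<open>This is the Frobenius identity \<open>(1 + \<sigma>) ^ (2 ^ n) = 1 + \<sigma> ^ (2 ^ n)\<close> for the shift \<open>\<sigma>\<close>:
  squaring the map for \<open>n\<close> produces the middle term twice, and it cancels.\<close>

lemma sum_ca_funpow_power_two: "(sum_ca ^^ (2 ^ n)) a l = a l + a (l + 2 ^ n)"
proof (induction n arbitrary: a l)
  case 0
  show ?case by (simp add: sum_ca_def)
next
  case (Suc n)
  have cancel: "x + y + (y + z) = x + z" for x y z :: bit
    by (cases x; cases y; cases z) simp_all
  have "(sum_ca ^^ (2 ^ Suc n)) a l = (sum_ca ^^ (2 ^ n)) ((sum_ca ^^ (2 ^ n)) a) l"
    by (simp add: mult_2 funpow_add)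
  also have "\<dots> = a l + a (l + 2 ^ n) + (a (l + 2 ^ n) + a (l + 2 ^ n + 2 ^ n))"
    by (simp only: Suc.IH)
  also have "\<dots> = a l + a (l + 2 ^ n + 2 ^ n)"
    by (rule cancel)
  also have "l + 2 ^ n + 2 ^ n = l + 2 ^ Suc n"
    by simp
  finally show ?case .
qed

lemma sum_ca_funpow_zero_block:
  assumes "\<And>m. l \<le> m \<Longrightarrow> m \<le> l + int i \<Longrightarrow> b m = 0"
  shows "(sum_ca ^^ i) b l = 0"
  using assms
proof (induction i arbitrary: l)
  case 0
  then show ?case by simp
next
  case (Suc i)
  have "(sum_ca ^^ i) b l = 0" "(sum_ca ^^ i) b (l + 1) = 0"
    by (rule Suc.IH; rule Suc.prems; simp)+
  then show ?case by (simp add: sum_ca_def[of "(sum_ca ^^ i) b"])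
qed

definition zero_cylinder :: "nat \<Rightarrow> (int \<Rightarrow> bit) set" where
  "zero_cylinder M = {a. \<forall>l\<in>{0..<int M}. a l = 0}"

lemma recurrence_set_subset:
  assumes "real (i + M) \<le> \<delta> * 2 ^ n"
  shows "recurrence_set \<delta> n \<subseteq> (sum_ca ^^ (2 ^ n + i)) -` zero_cylinder M"
proof
  fix a assume a: "a \<in> recurrence_set \<delta> n"
  have window: "(sum_ca ^^ (2 ^ n)) a m = 0" if "0 \<le> m" "m < int (i + M)" for m
  proof -
    have "real_of_int m < real (i + M)"
      using that by linarith
    with assms a that have "a m = a (m + 2 ^ n)"
      by (auto simp: recurrence_set_def)
    then show ?thesis
      by (simp add: sum_ca_funpow_power_two)
  qed
  have "(sum_ca ^^ (2 ^ n + i)) a l = 0" if "0 \<le> l" "l < int M" for l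
  proof -
    have "(sum_ca ^^ i) ((sum_ca ^^ (2 ^ n)) a) l = 0"
      by (rule sum_ca_funpow_zero_block, rule window) (use that in auto)
    then show ?thesis
      by (simp add: add.commute[of "2 ^ n"] funpow_add)
  qed
  then show "a \<in> (sum_ca ^^ (2 ^ n + i)) -` zero_cylinder M"
    by (simp add: zero_cylinder_def)
qed

text \<open>If \<open>J\<close> misses \<open>[N, N + D)\<close> with \<open>D \<ge> c N\<close>, then its proportion in \<open>[0, N + D)\<close> is at most
  \<open>1 / (1 + c)\<close>, which is bounded away from one.\<close>

lemma density_one_meets_intervals:
  assumes "has_density_one J" and c: "0 < (c :: real)"
  shows "\<forall>\<^sub>F N in sequentially. \<forall>D. c * real N \<le> real D \<longrightarrow> J \<inter> {N..<N + D} \<noteq> {}"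
proof -
  have "\<forall>\<^sub>F N in sequentially. 1 / (1 + c) < real (card (J \<inter> {..<N})) / real N"
    using assms by (intro order_tendstoD(1)[of _ 1]) (simp_all add: has_density_one_def)
  then obtain N0 where N0: "\<And>N. N0 \<le> N \<Longrightarrow> 1 / (1 + c) < real (card (J \<inter> {..<N})) / real N"
    by (auto simp: eventually_sequentially)
  have "J \<inter> {N..<N + D} \<noteq> {}" if N: "max N0 1 \<le> N" and D: "c * real N \<le> real D" for N D
  proof
    assume gap: "J \<inter> {N..<N + D} = {}"
    have "J \<inter> {..<N + D} \<subseteq> {..<N}"
    proof
      fix j assume "j \<in> J \<inter> {..<N + D}"
      with gap show "j \<in> {..<N}" by (cases "j < N") auto
    qed
    then have "card (J \<inter> {..<N + D}) \<le> N"
      using card_mono[of "{..<N}" "J \<inter> {..<N + D}"] by simp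
    then have "real (card (J \<inter> {..<N + D})) / real (N + D) \<le> real N / real (N + D)"
      by (intro divide_right_mono) simp_all
    also have "\<dots> \<le> 1 / (1 + c)"
      using N D c by (simp add: field_simps)
    finally show False
      using N0[of "N + D"] N by simp
  qed
  then show ?thesis
    unfolding eventually_sequentially by blast
qed

lemma continuous_on_indicator_zero_cylinder:
  "continuous_on UNIV (indicator (zero_cylinder M) :: (int \<Rightarrow> bit) \<Rightarrow> real)"
proof -
  have "continuous_on UNIV (\<lambda>a :: int \<Rightarrow> bit. of_bool (a l = 0) :: real)" for l
  proof (rule continuous_on_compose2[of UNIV "\<lambda>x :: bit. of_bool (x = 0)"])
    show "continuous_on UNIV (\<lambda>x :: bit. of_bool (x = 0) :: real)"
      by (simp add: continuous_on_open_vimage Topological_Spaces.open_discrete)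
  qed (auto intro: continuous_on_product_coordinates)
  then have "continuous_on UNIV
      (\<lambda>a :: int \<Rightarrow> bit. \<Prod>l\<in>{0..<int M}. of_bool (a l = 0) :: real)"
    by (intro continuous_on_prod)
  also have "(\<lambda>a :: int \<Rightarrow> bit. \<Prod>l\<in>{0..<int M}. of_bool (a l = 0) :: real) =
      indicator (zero_cylinder M)"
  proof
    fix a :: "int \<Rightarrow> bit"
    show "(\<Prod>l\<in>{0..<int M}. of_bool (a l = 0) :: real) = indicator (zero_cylinder M) a"
    proof (cases "a \<in> zero_cylinder M")
      case True
      then show ?thesis by (simp add: zero_cylinder_def)
    next
      case False
      then obtain l where "l \<in> {0..<int M}" "a l \<noteq> 0"
        by (auto simp: zero_cylinder_def)
      then have "(\<Prod>l\<in>{0..<int M}. of_bool (a l = 0) :: real) = 0"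
        by (intro prod_zero) auto
      with False show ?thesis by simp
    qed
  qed
  finally show ?thesis .
qed

lemma zero_cylinder_measurable: "zero_cylinder M \<in> sets borel"
proof -
  have "open ((indicator (zero_cylinder M) :: (int \<Rightarrow> bit) \<Rightarrow> real) -` {0<..})"
    by (rule open_vimage[OF _ continuous_on_indicator_zero_cylinder]) simp
  also have "(indicator (zero_cylinder M) :: (int \<Rightarrow> bit) \<Rightarrow> real) -` {0<..} = zero_cylinder M"
    by (auto simp: indicator_def split: if_splits)
  finally show ?thesis by (rule borel_open)
qed

lemma measure_uniform_bernoulli_zero_cylinder:
  "measure uniform_bernoulli (zero_cylinder M) = (1 / 2) ^ M"
  using emeasure_uniform_bernoulli_cylinder[of "{0..<int M}" "\<lambda>_. 0"]
  by (simp add: zero_cylinder_def measure_def)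

theorem proposition15p1:
  fixes \<mu> :: "(int \<Rightarrow> bit) measure"
  assumes "prob_space \<mu>"
    and "sets \<mu> = sets borel"
    and "dyadically_recurrent \<mu>"
  shows "\<not> asymptotically_randomizes sum_ca \<mu>"
proof
  assume "asymptotically_randomizes sum_ca \<mu>"
  then obtain J where J: "has_density_one J"
    and conv: "weak_star_converges (\<lambda>j. distr \<mu> borel (sum_ca ^^ j)) uniform_bernoulli
      (inf sequentially (principal J))"
    by (auto simp: asymptotically_randomizes_def)
  from assms(3) obtain n :: "nat \<Rightarrow> nat" and \<epsilon> \<delta> :: real
    where n: "filterlim n at_top sequentially" and \<epsilon>: "0 < \<epsilon>" and \<delta>: "0 < \<delta>"
      and rec: "\<And>k. \<epsilon> < measure \<mu> (recurrence_set \<delta> (n k))"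
    by (auto simp: dyadically_recurrent_def)
  interpret prob_space \<mu> by fact
  have space: "space \<mu> = UNIV"
    using sets_eq_imp_space_eq[OF assms(2)] by simp
  have ca: "sum_ca ^^ j \<in> measurable \<mu> borel" for j
    using measurable_sum_ca_funpow measurable_cong_sets[OF assms(2) refl] by blast
  obtain M where M: "(1 / 2) ^ M < \<epsilon>"
    using real_arch_pow_inv[OF \<epsilon>, of "1 / 2"] by auto

  have "((\<lambda>j. integral\<^sup>L (distr \<mu> borel (sum_ca ^^ j)) (indicator (zero_cylinder M) :: _ \<Rightarrow> real))
      \<longlongrightarrow> integral\<^sup>L uniform_bernoulli (indicator (zero_cylinder M)))
      (inf sequentially (principal J))"
    using conv continuous_on_indicator_zero_cylinder[of M]
    unfolding weak_star_converges_def by blast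
  moreover have "integral\<^sup>L uniform_bernoulli (indicator (zero_cylinder M) :: _ \<Rightarrow> real) = (1 / 2) ^ M"
    using sets_eq_imp_space_eq[OF sets_uniform_bernoulli]
    by (simp add: measure_uniform_bernoulli_zero_cylinder)
  moreover have "integral\<^sup>L (distr \<mu> borel (sum_ca ^^ j)) (indicator (zero_cylinder M) :: _ \<Rightarrow> real) =
      measure \<mu> ((sum_ca ^^ j) -` zero_cylinder M)" for j
    by (simp add: measure_distr[OF ca zero_cylinder_measurable] space)
  ultimately have "((\<lambda>j. measure \<mu> ((sum_ca ^^ j) -` zero_cylinder M)) \<longlongrightarrow> (1 / 2) ^ M)
      (inf sequentially (principal J))"
    by simp
  then have "\<forall>\<^sub>F j in inf sequentially (principal J).
      measure \<mu> ((sum_ca ^^ j) -` zero_cylinder M) < \<epsilon>"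
    using M by (rule order_tendstoD(2))
  then obtain j0 where small:
    "\<And>j. j0 \<le> j \<Longrightarrow> j \<in> J \<Longrightarrow> measure \<mu> ((sum_ca ^^ j) -` zero_cylinder M) < \<epsilon>"
    by (auto simp: eventually_inf_principal eventually_sequentially)

  have pow: "filterlim (\<lambda>k. 2 ^ n k :: nat) at_top sequentially"
  proof (rule filterlim_at_top_mono[OF n])
    show "\<forall>\<^sub>F k in sequentially. n k \<le> 2 ^ n k"
      by (intro always_eventually allI less_imp_le less_exp)
  qed
  have "\<forall>\<^sub>F k in sequentially. \<forall>D. \<delta> / 2 * real (2 ^ n k) \<le> real D \<longrightarrow>
      J \<inter> {2 ^ n k..<2 ^ n k + D} \<noteq> {}"
    using eventually_compose_filterlim[OF density_one_meets_intervals[OF J, of "\<delta> / 2"] pow] \<delta>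
    by simp
  moreover have "\<forall>\<^sub>F k in sequentially. max j0 (nat \<lceil>2 * (real M + 1) / \<delta>\<rceil>) \<le> 2 ^ n k"
    using pow unfolding filterlim_at_top by blast
  ultimately obtain k
    where meets: "\<And>D. \<delta> / 2 * real (2 ^ n k) \<le> real D \<Longrightarrow> J \<inter> {2 ^ n k..<2 ^ n k + D} \<noteq> {}"
      and large: "max j0 (nat \<lceil>2 * (real M + 1) / \<delta>\<rceil>) \<le> 2 ^ n k"
    using eventually_happens'[OF sequentially_bot eventually_conj] by blast
  \<comment> \<open>\<open>D\<close> counts the times at which the zeros persist: the window of length \<open>\<delta> 2 ^ n\<close> loses less than
    one cell to rounding and \<open>M\<close> cells to the cylinder. For large \<open>n\<close> at least half of it remains,
    which is why \<open>J\<close> was tested against the proportion \<open>\<delta> / 2\<close>.\<close>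
  define D where "D = nat \<lfloor>\<delta> * 2 ^ n k\<rfloor> - M"
  have "2 * (real M + 1) / \<delta> \<le> real (2 ^ n k)"
    using large by linarith
  then have half: "real M + 1 \<le> \<delta> / 2 * 2 ^ n k"
    using \<delta> by (simp add: field_simps)
  then have D: "real (D + M) \<le> \<delta> * 2 ^ n k" "\<delta> / 2 * 2 ^ n k \<le> real D"
    unfolding D_def by linarith+
  from meets[of D] D(2) obtain j where j: "j \<in> J" "2 ^ n k \<le> j" "j < 2 ^ n k + D"
    by auto
  define i where "i = j - 2 ^ n k"
  have "i < D" and ji: "j = 2 ^ n k + i"
    using j by (auto simp: i_def)
  then have "real (i + M) \<le> \<delta> * 2 ^ n k"
    using D(1) by simp
  then have "recurrence_set \<delta> (n k) \<subseteq> (sum_ca ^^ j) -` zero_cylinder M"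
    unfolding ji by (rule recurrence_set_subset)
  moreover have "(sum_ca ^^ j) -` zero_cylinder M \<in> sets \<mu>"
    using measurable_sets[OF ca zero_cylinder_measurable] by (simp add: space)
  ultimately have "measure \<mu> (recurrence_set \<delta> (n k))
      \<le> measure \<mu> ((sum_ca ^^ j) -` zero_cylinder M)"
    by (rule finite_measure_mono)
  also have "\<dots> < \<epsilon>"
    using large j by (intro small) auto
  finally show False
    using rec[of k] by simp
qed

end
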